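(* Let $d\in\mathbb{N}$, $d\ge 1$. There is a constant $C_d>0$ depending only on $d$ such that the following holds. Let $f:\mathbb{R}^d\to\mathbb{R}$ and $L_1>0$ satisfy $|f(\mathbf{X})-f(\mathbf{X}')|\le L_1\|\mathbf{X}-\mathbf{X}'\|_1$ for all $\mathbf{X},\mathbf{X}'\in\mathbb{R}^d$, and assume $\|f\|_1=\int_{\mathbb{R}^d}|f(\mathbf{X})|\,d\mathbf{X}<\infty$. Let $\mu$ be any Borel probability measure on $\mathbb{R}^d$, put $\|f\|_\mu=\int|f(\mathbf{X})|\,d\mu(\mathbf{X})$ (with $\|f\|_\mu\neq 0$, so that the bound below is defined), and let $\epsilon>0$. Then there exists a single hidden layer AdderNet $A:\mathbb{R}^d\to\mathbb{R}$ with ReLU activation, of width no more than $$\frac{\|f\|_1\,\|f\|_\mu}{\min\left(\epsilon^{d+2}L_1^2,\ \epsilon^{d+1}L_1\|f\|_\mu\right)},$$ such that $$\int (f(\mathbf{X})-A(\mathbf{X}))^2\,d\mu(\mathbf{X})\le C_d\,\epsilon^2L_1^2 .$$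
   Context: $\|\mathbf{x}\|_1=\sum_j|x_j|$ for a vector $\mathbf{x}$; for the function $f$, $\|f\|_1$ is its Lebesgue $L^1(\mathbb{R}^d)$ norm. An adder layer is a map $L:\mathbb{R}^{d_{in}}\to\mathbb{R}^{d_{out}}$ of the form $L(\mathbf{X})_i = a_i\|\mathbf{W}_i-\mathbf{X}\|_1 + b_i$ for $i=1,\dots,d_{out}$, where $\mathbf{W}_i\in\mathbb{R}^{d_{in}}$ and $a_i,b_i\in\mathbb{R}$ are arbitrary parameters. $\mathrm{ReLU}(x)=\max(x,0)$, applied coordinatewise to vectors. A single hidden layer AdderNet with ReLU activation and width $t$ is a function $A:\mathbb{R}^d\to\mathbb{R}$ of the form $A(\mathbf{X})=\Lambda_2(\mathrm{ReLU}(\Lambda_1(\mathbf{X})))$, where $\Lambda_1:\mathbb{R}^d\to\mathbb{R}^t$ and $\Lambda_2:\mathbb{R}^t\to\mathbb{R}$ are adder layers; $t$ is a nonnegative integer, a network of width $0$ being a constant function. *)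

theory Defs
  imports "HOL-Analysis.Analysis" "HOL-Probability.Probability"
begin

text \<open>
  The width of a network is a bound natural number, so the vectors on both sides of a layer are
  represented as functions on explicit finite index sets; values outside these sets are irrelevant.
  A point \<open>X :: real ^ 'd\<close> is the family \<open>vec_nth X\<close>, indexed by \<open>UNIV :: 'd set\<close>.
\<close>

definition l1_norm :: "'i set \<Rightarrow> ('i \<Rightarrow> real) \<Rightarrow> real" where
  "l1_norm I x = (\<Sum>j\<in>I. \<bar>x j\<bar>)"

definition adder_layer ::
    "'i set \<Rightarrow> 'o set \<Rightarrow> (('i \<Rightarrow> real) \<Rightarrow> ('o \<Rightarrow> real)) \<Rightarrow> bool" where
  "adder_layer I J \<Lambda> \<longleftrightarrow>
     (\<exists>(W :: 'o \<Rightarrow> 'i \<Rightarrow> real) (a :: 'o \<Rightarrow> real) (b :: 'o \<Rightarrow> real).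
        \<forall>X. \<forall>i\<in>J. \<Lambda> X i = a i * l1_norm I (\<lambda>j. W i j - X j) + b i)"

definition relu :: "real \<Rightarrow> real" where
  "relu x = max x 0"

text \<open>
  For \<open>t = 0\<close> the second layer is evaluated on the empty family, so that \<open>A\<close> is an arbitrary
  constant function.
\<close>

definition relu_adder_net :: "nat \<Rightarrow> (real ^ 'd \<Rightarrow> real) \<Rightarrow> bool" where
  "relu_adder_net t A \<longleftrightarrow>
     (\<exists>(\<Lambda>1 :: ('d \<Rightarrow> real) \<Rightarrow> (nat \<Rightarrow> real)) (\<Lambda>2 :: (nat \<Rightarrow> real) \<Rightarrow> (unit \<Rightarrow> real)).
        adder_layer (UNIV :: 'd set) {..<t} \<Lambda>1 \<and>
        adder_layer {..<t} (UNIV :: unit set) \<Lambda>2 \<and>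
        (\<forall>X. A X = \<Lambda>2 (\<lambda>i. relu (\<Lambda>1 (vec_nth X) i)) ()))"

end

theory Submission imports Defs begin

text \<open>
  With \<open>\<phi>(z) = max (1 - \<parallel>z\<parallel>\<^sub>1 / \<epsilon>) 0\<close> and \<open>\<kappa> = \<integral>\<phi>\<close>, of order \<open>\<epsilon>^d\<close>, the average \<open>(f * \<phi>) / \<kappa>\<close> is
  within \<open>\<epsilon> L\<close> of \<open>f\<close>. Up to the factor \<open>\<parallel>f\<parallel>\<^sub>1\<close>, it is the mean of \<open>sgn (f y) \<phi>(x - y)\<close> for \<open>y\<close> drawn
  with density \<open>\<bar>f\<bar> / \<parallel>f\<parallel>\<^sub>1\<close>, so \<open>n\<close> samples give a mean square error of at most
  \<open>\<parallel>f\<parallel>\<^sub>1 (\<parallel>f\<parallel>\<^sub>\<mu> + \<epsilon> L) / (\<kappa> n)\<close>: the second moment is bounded by averaging \<open>\<bar>f\<bar>\<close>, which is itself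
  Lipschitz, against \<open>\<phi>\<close>. If the width bound is below \<open>1\<close>, then \<open>\<parallel>f\<parallel>\<^sub>1 < \<epsilon>^(d+1) L\<close>, the average is
  \<open>O(\<epsilon> L)\<close>, and \<open>A = 0\<close> suffices.
\<close>

section \<open>Sequential choice of sample points in a probability space\<close>

text \<open>
  Instead of sampling independently, the points are chosen one after another: for a fixed partial
  sum \<open>S\<close>, the cross term of \<open>(S + g y - h)\<^sup>2\<close> vanishes on average over \<open>y\<close>.
\<close>

lemma greedy_sampling:
  fixes g :: "'a \<Rightarrow> 'b \<Rightarrow> real"
  assumes "prob_space P" "prob_space M"
    and g [measurable]: "case_prod g \<in> borel_measurable (P \<Otimes>\<^sub>M M)"
    and bnd: "\<And>y x. \<bar>g y x\<bar> \<le> B"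
  defines "h \<equiv> \<lambda>x. LINT y|P. g y x"
  shows "\<exists>Y. (LINT x|M. (\<Sum>i<n. g (Y i) x - h x)\<^sup>2)
           \<le> real n * (LINT x|M. (LINT y|P. (g y x)\<^sup>2)) \<and> (\<forall>i<n. Y i \<in> space P)"
proof (induction n)
  case 0
  then show ?case by simp
next
  case (Suc n)
  interpret P: prob_space P by fact
  interpret M: prob_space M by fact
  interpret PM: pair_prob_space P M ..
  have B0: "B \<ge> 0" using bnd[of undefined undefined] by linarith
  let ?V = "LINT x|M. (LINT y|P. (g y x)\<^sup>2)"
  from Suc obtain Y where Y: "(LINT x|M. (\<Sum>i<n. g (Y i) x - h x)\<^sup>2) \<le> real n * ?V"
    "\<forall>i<n. Y i \<in> space P" by blast
  have h_meas [measurable]: "h \<in> borel_measurable M"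
    unfolding h_def by measurable
  have gx [measurable]: "g y \<in> borel_measurable M" if "y \<in> space P" for y
    using that by measurable
  have gy [measurable]: "(\<lambda>y. g y x) \<in> borel_measurable P" if "x \<in> space M" for x
    using that by measurable
  define S where "S = (\<lambda>x. \<Sum>i<n. g (Y i) x - h x)"
  have S_meas [measurable]: "S \<in> borel_measurable M"
    unfolding S_def using Y(2) by (intro borel_measurable_sum borel_measurable_diff) auto
  have int_g: "integrable P (\<lambda>y. g y x)" if "x \<in> space M" for x
    using bnd that by (intro P.integrable_const_bound[of _ B]) auto
  have int_g2: "integrable P (\<lambda>y. (g y x)\<^sup>2)" if "x \<in> space M" for x
    using bnd that by (intro P.integrable_const_bound[of _ "B\<^sup>2"])
      (auto simp: abs_le_square_iff[symmetric] intro: order_trans[OF _ abs_ge_self])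
  have h_bnd: "\<bar>h x\<bar> \<le> B" if "x \<in> space M" for x
  proof -
    have "\<bar>h x\<bar> \<le> (LINT y|P. \<bar>g y x\<bar>)"
      unfolding h_def by (rule integral_abs_bound)
    also have "\<dots> \<le> (LINT y|P. B)"
      using int_g[OF that] bnd by (intro integral_mono) auto
    finally show ?thesis by (simp add: P.prob_space)
  qed
  \<comment> \<open>A crude uniform bound with room for one summand more than \<open>S\<close> has;
    it makes the squares of \<open>S\<close> and of the extended sum integrable.\<close>
  define K where "K = (real (Suc n) * (2 * B))\<^sup>2"
  have S_bnd: "\<bar>S x\<bar> \<le> real n * (2 * B)" if "x \<in> space M" for x
  proof -
    have "\<bar>S x\<bar> \<le> (\<Sum>i<n. \<bar>g (Y i) x - h x\<bar>)" unfolding S_def by (rule sum_abs)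
    also have "\<dots> \<le> (\<Sum>i<n. 2 * B)"
    proof (rule sum_mono)
      fix i show "\<bar>g (Y i) x - h x\<bar> \<le> 2 * B"
        using bnd[of "Y i" x] h_bnd[OF that] by linarith
    qed
    finally show ?thesis by simp
  qed
  have sq_bnd: "(S x + (g y x - h x))\<^sup>2 \<le> K" if "x \<in> space M" for x y
  proof -
    have "\<bar>S x + (g y x - h x)\<bar> \<le> real (Suc n) * (2 * B)"
      using S_bnd[OF that] h_bnd[OF that] bnd[of y x] by (simp add: algebra_simps)
    then show ?thesis unfolding K_def by (metis abs_ge_zero power2_abs power_mono)
  qed
  have S2_bnd: "(S x)\<^sup>2 \<le> K" if "x \<in> space M" for x
  proof -
    have "\<bar>S x\<bar> \<le> real (Suc n) * (2 * B)"
      using S_bnd[OF that] B0 by (simp add: algebra_simps)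
    then show ?thesis unfolding K_def by (metis abs_ge_zero power2_abs power_mono)
  qed
  \<comment> \<open>\<open>q y\<close> is the mean square error after appending \<open>y\<close> as
    the next point. The aim is a \<open>y\<close> that does no worse than the average of
    \<open>q\<close> over \<open>P\<close>.\<close>
  define q where "q = (\<lambda>y. LINT x|M. (S x + (g y x - h x))\<^sup>2)"
  have int_pair: "integrable (P \<Otimes>\<^sub>M M) (\<lambda>(y, x). (S x + (g y x - h x))\<^sup>2)"
    by (rule PM.integrable_const_bound[of _ K]) (auto simp: space_pair_measure sq_bnd)
  have int_V: "integrable M (\<lambda>x. LINT y|P. (g y x)\<^sup>2)"
  proof (rule M.integrable_const_bound[of _ "B\<^sup>2"])
    show "AE x in M. norm (LINT y|P. (g y x)\<^sup>2) \<le> B\<^sup>2"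
    proof (rule AE_I2)
      fix x assume x: "x \<in> space M"
      have "(LINT y|P. (g y x)\<^sup>2) \<le> (LINT y|P. B\<^sup>2)"
        using int_g2[OF x] bnd by (intro integral_mono)
          (auto simp: abs_le_square_iff[symmetric] intro: order_trans[OF _ abs_ge_self])
      then show "norm (LINT y|P. (g y x)\<^sup>2) \<le> B\<^sup>2" by (simp add: P.prob_space)
    qed
  qed measurable
  have int_S2: "integrable M (\<lambda>x. (S x)\<^sup>2)"
    using S2_bnd by (intro M.integrable_const_bound[of _ K]) auto
  \<comment> \<open>Since \<open>h x\<close> is the mean of \<open>g y x\<close>, the cross term
    with \<open>S x\<close> integrates to zero. What remains besides \<open>(S x)\<^sup>2\<close> is
    the variance of \<open>g y x\<close>, bounded here by its second moment.\<close>
  have inner: "(LINT y|P. (S x + (g y x - h x))\<^sup>2) \<le> (S x)\<^sup>2 + (LINT y|P. (g y x)\<^sup>2)"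
    if x: "x \<in> space M" for x
  proof -
    have "(LINT y|P. (S x + (g y x - h x))\<^sup>2)
        = (LINT y|P. (S x - h x)\<^sup>2 + 2 * (S x - h x) * g y x + (g y x)\<^sup>2)"
      by (rule Bochner_Integration.integral_cong) (auto simp: power2_eq_square algebra_simps)
    also have "\<dots> = (S x - h x)\<^sup>2 + 2 * (S x - h x) * h x + (LINT y|P. (g y x)\<^sup>2)"
      using int_g[OF x] int_g2[OF x] by (simp add: h_def P.prob_space)
    also have "\<dots> = (S x)\<^sup>2 - (h x)\<^sup>2 + (LINT y|P. (g y x)\<^sup>2)"
      by (simp add: power2_eq_square algebra_simps)
    finally show ?thesis by simp
  qed
  have int_q: "integrable P q"
    unfolding q_def using PM.integrable_fst[OF int_pair] by simp
  have "integral\<^sup>L P q = (LINT x|M. (LINT y|P. (S x + (g y x - h x))\<^sup>2))"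
    unfolding q_def using PM.Fubini_integral[OF int_pair] by simp
  also have "\<dots> \<le> (LINT x|M. (S x)\<^sup>2 + (LINT y|P. (g y x)\<^sup>2))"
    using PM.integrable_snd[OF int_pair] int_S2 int_V inner
    by (intro integral_mono) auto
  also have "\<dots> = (LINT x|M. (S x)\<^sup>2) + ?V"
    using int_S2 int_V by simp
  also have "\<dots> \<le> real (Suc n) * ?V"
    using Y(1) by (simp add: S_def algebra_simps)
  finally have mean: "integral\<^sup>L P q \<le> real (Suc n) * ?V" .
  \<comment> \<open>If \<open>q\<close> exceeded its mean at every point, integrating over a
    probability space would keep the inequality strict.\<close>
  have "\<exists>y\<in>space P. q y \<le> integral\<^sup>L P q"
  proof (rule ccontr)
    assume "\<not> ?thesis"
    then have "(LINT y|P. integral\<^sup>L P q) < integral\<^sup>L P q"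
      using int_q by (intro P.integral_less_AE_space) (auto simp: P.emeasure_space_1 not_le)
    then show False by (simp add: P.prob_space)
  qed
  then obtain y where y: "y \<in> space P" "q y \<le> integral\<^sup>L P q" by blast
  have "(\<Sum>i<Suc n. g ((Y(n := y)) i) x - h x) = S x + (g y x - h x)" for x
    by (simp add: S_def)
  then have "(LINT x|M. (\<Sum>i<Suc n. g ((Y(n := y)) i) x - h x)\<^sup>2) \<le> real (Suc n) * ?V"
    using y mean by (simp add: q_def)
  moreover have "\<forall>i<Suc n. (Y(n := y)) i \<in> space P"
    using Y(2) y by (auto simp: less_Suc_eq)
  ultimately show ?case by blast
qed

section \<open>The tent function on the l1 ball and its integral\<close>

text \<open>Shaped as the output of one hidden unit: with centre \<open>w\<close>, slope
  \<open>- 1 / \<epsilon>\<close> and offset \<open>1\<close>, the unit returns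
  \<open>bump \<epsilon> (X - w)\<close> after ReLU.\<close>

definition bump :: "real \<Rightarrow> real ^ 'd \<Rightarrow> real" where
  "bump \<epsilon> z = relu (1 - l1_norm UNIV (vec_nth z) / \<epsilon>)"

lemma l1_norm_continuous: "continuous_on UNIV (\<lambda>z :: real ^ 'd. l1_norm UNIV (vec_nth z))"
  unfolding l1_norm_def by (intro continuous_intros)

lemma l1_norm_nonneg: "l1_norm I x \<ge> 0"
  unfolding l1_norm_def by (intro sum_nonneg) auto

lemma bump_measurable [measurable]: "bump \<epsilon> \<in> borel_measurable borel"
  unfolding bump_def relu_def
  by (intro borel_measurable_max borel_measurable_diff borel_measurable_divide
      borel_measurable_continuous_onI l1_norm_continuous) auto

lemma bump_nonneg: "bump \<epsilon> z \<ge> 0"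
  by (simp add: bump_def relu_def)

lemma bump_le_1: "\<epsilon> > 0 \<Longrightarrow> bump \<epsilon> z \<le> 1"
  by (simp add: bump_def relu_def l1_norm_nonneg)

lemma bump_support:
  assumes "\<epsilon> > 0" "bump \<epsilon> z \<noteq> 0"
  shows "l1_norm UNIV (vec_nth z) \<le> \<epsilon>"
  using assms by (auto simp: bump_def relu_def max_def field_simps split: if_splits)

text \<open>The l1 norm dominates the Euclidean norm, so the support lies in a Euclidean ball of
  radius \<open>\<epsilon>\<close>, whose indicator dominates the bump.\<close>

lemma bump_integrable:
  assumes "\<epsilon> > 0"
  shows "integrable lborel (bump \<epsilon> :: real ^ 'd \<Rightarrow> real)"
proof (rule Bochner_Integration.integrable_bound)
  let ?Q = "cball 0 \<epsilon> :: (real ^ 'd) set"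
  show "integrable lborel (indicat_real ?Q)"
    by (intro integrable_real_indicator emeasure_lborel_cball_finite) auto
  show "AE z in lborel. norm (bump \<epsilon> z) \<le> norm (indicat_real ?Q z)"
  proof (rule AE_I2)
    fix z :: "real ^ 'd"
    have "norm z \<le> l1_norm UNIV (vec_nth z)"
      unfolding l1_norm_def by (rule norm_le_l1_cart)
    then show "norm (bump \<epsilon> z) \<le> norm (indicat_real ?Q z)"
      using bump_support[OF assms, of z] bump_le_1[OF assms, of z] bump_nonneg[of \<epsilon> z]
      by (cases "bump \<epsilon> z = 0") auto
  qed
qed measurable

text \<open>The bump is at least 1/2 on a cube of side \<open>\<epsilon> / CARD('d)\<close>, and
  half the volume of that cube is the bound. What matters later is the order
  \<open>\<epsilon> ^ CARD('d)\<close> with a factor depending on the dimension alone.\<close>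

lemma bump_integral_ge:
  assumes "\<epsilon> > 0"
  shows "(LINT z|lborel. bump \<epsilon> (z :: real ^ 'd)) \<ge> \<epsilon> ^ CARD('d) / (2 * real CARD('d) ^ CARD('d))"
proof -
  \<comment> \<open>With this half-side the l1 norm on the cube is at most
    \<open>CARD('d) * r = \<epsilon> / 2\<close>.\<close>
  define r where "r = \<epsilon> / (2 * real CARD('d))"
  have r: "r > 0" using assms by (simp add: r_def)
  let ?Q = "cbox (\<chi> i. - r) (\<chi> i. r) :: (real ^ 'd) set"
  have "measure lborel ?Q = (2 * r) ^ CARD('d)"
    using r by (subst content_cbox_if_cart) (auto simp: interval_eq_empty_cart not_less)
  then have "(LINT z|lborel. indicat_real ?Q z / 2) = \<epsilon> ^ CARD('d) / (2 * real CARD('d) ^ CARD('d))"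
    by (simp add: r_def power_divide)
  moreover have "(LINT z|lborel. indicat_real ?Q z / 2) \<le> (LINT z|lborel. bump \<epsilon> (z :: real ^ 'd))"
  proof (rule integral_mono)
    show "integrable lborel (\<lambda>z. indicat_real ?Q z / 2)"
      by (intro integrable_divide integrable_real_indicator emeasure_lborel_cbox_finite) auto
    show "indicat_real ?Q z / 2 \<le> bump \<epsilon> z" for z :: "real ^ 'd"
    proof (cases "z \<in> ?Q")
      case True
      then have "\<bar>z $ i\<bar> \<le> r" for i by (auto simp: mem_box_cart abs_le_iff minus_le_iff)
      then have "l1_norm UNIV (vec_nth z) \<le> (\<Sum>i\<in>(UNIV :: 'd set). r)"
        unfolding l1_norm_def by (intro sum_mono) auto
      also have "\<dots> = \<epsilon> / 2" by (simp add: r_def)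
      finally have "l1_norm UNIV (vec_nth z) / \<epsilon> \<le> 1 / 2" using assms by (simp add: field_simps)
      then have "1 / 2 \<le> bump \<epsilon> z" unfolding bump_def relu_def by linarith
      then show ?thesis using True by simp
    qed (simp add: bump_nonneg)
  qed (use bump_integrable[OF assms] in auto)
  ultimately show ?thesis by simp
qed

text \<open>An affine map with factor -1 has Jacobian of modulus 1. This turns integrals of the bump
  in \<open>z\<close> into integrals over its centre \<open>y\<close>, where
  \<open>z = x - y\<close>.\<close>

lemma lborel_distr_reflect:
  fixes x :: "'a :: euclidean_space"
  shows "distr lborel borel (\<lambda>y. x - y) = lborel"
  using lborel_affine[of "-1" x] by (simp add: density_1)

lemma bump_reflect_integral:
  "(LINT y|lborel. bump \<epsilon> (x - y :: real ^ 'd)) = (LINT z|lborel. bump \<epsilon> (z :: real ^ 'd))"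
proof -
  have "(LINT z|lborel. bump \<epsilon> (z :: real ^ 'd)) = (LINT z|distr lborel borel (\<lambda>y. x - y). bump \<epsilon> z)"
    by (simp add: lborel_distr_reflect)
  also have "\<dots> = (LINT y|lborel. bump \<epsilon> (x - y))"
    by (rule integral_distr) auto
  finally show ?thesis by simp
qed

lemma bump_reflect_integrable:
  assumes "\<epsilon> > 0"
  shows "integrable lborel (\<lambda>y. bump \<epsilon> (x - y :: real ^ 'd))"
proof -
  have "integrable (distr lborel borel (\<lambda>y. x - y)) (bump \<epsilon> :: real ^ 'd \<Rightarrow> real)"
    using bump_integrable[OF assms] by (simp add: lborel_distr_reflect)
  then show ?thesis by (subst (asm) integrable_distr_eq) auto
qed

section \<open>Averages of Lipschitz functions against the bump\<close>

lemma integrable_mult_bump: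
  fixes f :: "real ^ 'd \<Rightarrow> real"
  assumes "\<epsilon> > 0" "integrable lborel f"
  shows "integrable lborel (\<lambda>y. f y * bump \<epsilon> (x - y))"
proof (rule Bochner_Integration.integrable_bound)
  show "integrable lborel f" by fact
  show "AE y in lborel. norm (f y * bump \<epsilon> (x - y)) \<le> norm (f y)"
    using bump_le_1[OF assms(1)] by (intro AE_I2) (auto simp: abs_mult bump_nonneg intro!: mult_left_le)
qed (use assms in measurable)

lemma abs_integral_mult_bump_le:
  fixes f :: "real ^ 'd \<Rightarrow> real"
  assumes "\<epsilon> > 0" "integrable lborel f"
  shows "\<bar>LINT y|lborel. f y * bump \<epsilon> (x - y)\<bar> \<le> (LINT y|lborel. \<bar>f y\<bar>)"
proof -
  have "\<bar>LINT y|lborel. f y * bump \<epsilon> (x - y)\<bar> \<le> (LINT y|lborel. \<bar>f y * bump \<epsilon> (x - y)\<bar>)"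
    by (rule integral_abs_bound)
  also have "\<dots> \<le> (LINT y|lborel. \<bar>f y\<bar>)"
    using assms bump_le_1[OF assms(1)]
    by (intro integral_mono integrable_abs integrable_mult_bump)
      (auto simp: abs_mult bump_nonneg intro!: mult_left_le)
  finally show ?thesis .
qed

text \<open>Only points \<open>y\<close> within l1 distance \<open>\<epsilon>\<close> of
  \<open>x\<close> contribute, and there \<open>f\<close> differs from \<open>f x\<close> by at most
  \<open>\<epsilon> * L\<close>. Applied to \<open>f\<close> it bounds the bias; applied to its
  absolute value it bounds the second moment of the samples.\<close>

lemma bump_average_error:
  fixes f :: "real ^ 'd \<Rightarrow> real"
  assumes eps: "\<epsilon> > 0" and L: "L \<ge> 0"
    and lip: "\<And>X X'. \<bar>f X - f X'\<bar> \<le> L * l1_norm UNIV (vec_nth (X - X'))"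
    and int: "integrable lborel f"
  defines "\<kappa> \<equiv> LINT z|lborel. bump \<epsilon> (z :: real ^ 'd)"
  shows "\<bar>\<kappa> * f x - (LINT y|lborel. f y * bump \<epsilon> (x - y))\<bar> \<le> \<kappa> * (\<epsilon> * L)"
proof -
  note ints = bump_reflect_integrable[OF eps, of x] integrable_mult_bump[OF eps int, of x]
  have "\<kappa> * f x - (LINT y|lborel. f y * bump \<epsilon> (x - y))
      = (LINT y|lborel. f x * bump \<epsilon> (x - y) - f y * bump \<epsilon> (x - y))"
    using ints by (simp add: \<kappa>_def bump_reflect_integral)
  also have "\<bar>\<dots>\<bar> \<le> (LINT y|lborel. \<bar>f x * bump \<epsilon> (x - y) - f y * bump \<epsilon> (x - y)\<bar>)"
    by (rule integral_abs_bound)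
  also have "\<dots> \<le> (LINT y|lborel. (\<epsilon> * L) * bump \<epsilon> (x - y))"
  proof (rule integral_mono)
    show "\<bar>f x * bump \<epsilon> (x - y) - f y * bump \<epsilon> (x - y)\<bar> \<le> (\<epsilon> * L) * bump \<epsilon> (x - y)" for y
    proof (cases "bump \<epsilon> (x - y) = 0")
      case False
      have "\<bar>f x - f y\<bar> \<le> L * l1_norm UNIV (vec_nth (x - y))" by (rule lip)
      also have "\<dots> \<le> L * \<epsilon>" using bump_support[OF eps False] L by (rule mult_left_mono)
      finally have "\<bar>f x - f y\<bar> * bump \<epsilon> (x - y) \<le> (\<epsilon> * L) * bump \<epsilon> (x - y)"
        by (intro mult_right_mono) (auto simp: bump_nonneg mult.commute)
      then show ?thesis using bump_nonneg[of \<epsilon> "x - y"]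
        by (simp add: abs_mult flip: left_diff_distrib)
    qed simp
  qed (use ints in auto)
  also have "\<dots> = \<kappa> * (\<epsilon> * L)" by (simp add: \<kappa>_def bump_reflect_integral)
  finally show ?thesis .
qed

text \<open>The local average differs from \<open>f x\<close> by at most
  \<open>\<epsilon> * L\<close> and is itself at most the L1 norm of \<open>f\<close> divided by the
  integral of the bump. It shows that \<open>f\<close> is bounded, and small when its L1 norm is
  small compared with \<open>c\<close>.\<close>

lemma abs_lipschitz_integrable_le:
  fixes f :: "real ^ 'd \<Rightarrow> real"
  assumes eps: "\<epsilon> > 0" and L: "L \<ge> 0"
    and lip: "\<And>X X'. \<bar>f X - f X'\<bar> \<le> L * l1_norm UNIV (vec_nth (X - X'))"
    and int: "integrable lborel f"
    and kap: "0 < c" "c \<le> (LINT z|lborel. bump \<epsilon> (z :: real ^ 'd))"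
  shows "\<bar>f x\<bar> \<le> \<epsilon> * L + (LINT y|lborel. \<bar>f y\<bar>) / c"
proof -
  let ?\<kappa> = "LINT z|lborel. bump \<epsilon> (z :: real ^ 'd)" and ?N = "LINT y|lborel. \<bar>f y\<bar>"
  have k0: "?\<kappa> > 0" using kap by linarith
  have "\<bar>?\<kappa> * f x\<bar> \<le> ?\<kappa> * (\<epsilon> * L) + ?N"
    using bump_average_error[OF eps L lip int, of x] abs_integral_mult_bump_le[OF eps int, of x]
    by linarith
  then have "\<bar>f x\<bar> \<le> \<epsilon> * L + ?N / ?\<kappa>"
    using k0 by (simp add: abs_mult field_simps)
  also have "?N / ?\<kappa> \<le> ?N / c"
    using kap by (intro divide_left_mono) auto
  finally show ?thesis by simp
qed

section \<open>Signed sums of bumps as networks\<close>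

text \<open>
  All second-layer units share one output weight \<open>c\<close>; the sign of a unit is chosen through its
  weight \<open>W i\<close>, since \<open>\<bar>0 - y\<bar> = y\<close> and \<open>\<bar>1 - y\<bar> = 1 - y\<close> for \<open>0 \<le> y \<le> 1\<close>.
\<close>

lemma relu_adder_net_signed_bumps:
  fixes w :: "nat \<Rightarrow> real ^ 'd"
  assumes eps: "\<epsilon> > 0" and \<sigma>: "\<And>i. \<sigma> i = 1 \<or> \<sigma> i = - 1"
  shows "relu_adder_net t (\<lambda>X. c * (\<Sum>i<t. \<sigma> i * bump \<epsilon> (X - w i)))"
proof -
  define \<Lambda>1 :: "('d \<Rightarrow> real) \<Rightarrow> nat \<Rightarrow> real"
    where "\<Lambda>1 = (\<lambda>X i. (- 1 / \<epsilon>) * l1_norm UNIV (\<lambda>j. w i $ j - X j) + 1)"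
  define W :: "nat \<Rightarrow> real" where "W = (\<lambda>i. if \<sigma> i = 1 then 0 else 1)"
  \<comment> \<open>The offset cancels the sum of the \<open>W i\<close> that is left over from
    \<open>W i + \<sigma> i * bump \<epsilon> (X - w i)\<close>.\<close>
  define \<Lambda>2 :: "(nat \<Rightarrow> real) \<Rightarrow> unit \<Rightarrow> real"
    where "\<Lambda>2 = (\<lambda>Y u. c * l1_norm {..<t} (\<lambda>i. W i - Y i) + - c * (\<Sum>i<t. W i))"
  have "adder_layer UNIV {..<t} \<Lambda>1"
    unfolding adder_layer_def
    by (rule exI[of _ "\<lambda>i j. w i $ j"], rule exI[of _ "\<lambda>_. - 1 / \<epsilon>"], rule exI[of _ "\<lambda>_. 1"])
      (simp add: \<Lambda>1_def)
  moreover have "adder_layer {..<t} UNIV \<Lambda>2"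
    unfolding adder_layer_def
    by (rule exI[of _ "\<lambda>_. W"], rule exI[of _ "\<lambda>_. c"], rule exI[of _ "\<lambda>_. - c * (\<Sum>i<t. W i)"])
      (simp add: \<Lambda>2_def)
  moreover have "c * (\<Sum>i<t. \<sigma> i * bump \<epsilon> (X - w i)) = \<Lambda>2 (\<lambda>i. relu (\<Lambda>1 (vec_nth X) i)) ()" for X
  proof -
    have unit: "relu (\<Lambda>1 (vec_nth X) i) = bump \<epsilon> (X - w i)" for i
      by (simp add: \<Lambda>1_def bump_def l1_norm_def abs_minus_commute)
    have "\<bar>W i - bump \<epsilon> (X - w i)\<bar> = W i + \<sigma> i * bump \<epsilon> (X - w i)" for i
      using \<sigma>[of i] bump_nonneg[of \<epsilon> "X - w i"] bump_le_1[OF eps, of "X - w i"]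
      by (auto simp: W_def)
    then show ?thesis
      by (simp add: \<Lambda>2_def unit l1_norm_def sum.distrib algebra_simps)
  qed
  ultimately show ?thesis unfolding relu_adder_net_def by blast
qed

section \<open>Mean square error of the sampled network\<close>

lemma prob_space_normalized_density:
  fixes f :: "'a \<Rightarrow> real"
  assumes "integrable M f" "(LINT y|M. \<bar>f y\<bar>) > 0"
  shows "prob_space (density M (\<lambda>y. ennreal (\<bar>f y\<bar> / (LINT y|M. \<bar>f y\<bar>))))"
proof (rule prob_spaceI)
  let ?N = "LINT y|M. \<bar>f y\<bar>"
  have "(\<integral>\<^sup>+ y. ennreal (\<bar>f y\<bar> / ?N) \<partial>M) = ennreal (LINT y|M. \<bar>f y\<bar> / ?N)"
    using assms by (intro nn_integral_eq_integral) auto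
  also have "\<dots> = 1" using assms by simp
  finally show "emeasure (density M (\<lambda>y. ennreal (\<bar>f y\<bar> / ?N)))
      (space (density M (\<lambda>y. ennreal (\<bar>f y\<bar> / ?N)))) = 1"
    using assms by (subst emeasure_density) auto
qed

text \<open>The first summand of the bound is the squared bias of the local average, the second the
  variance of \<open>n\<close> samples; each factor 2 comes from splitting a square. The lower bound
  \<open>c\<close> replaces the integral of the bump, so that the estimate becomes explicit.\<close>

lemma sampled_net_error:
  fixes f :: "real ^ 'd \<Rightarrow> real" and \<mu> :: "(real ^ 'd) measure"
  assumes eps: "\<epsilon> > 0" and L: "L \<ge> 0"
    and lip: "\<And>X X'. \<bar>f X - f X'\<bar> \<le> L * l1_norm UNIV (vec_nth (X - X'))"
    and int: "integrable lborel f"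
    and prob: "prob_space \<mu>" and sets [measurable_cong]: "sets \<mu> = sets borel"
    and n: "n > 0" and N: "(LINT X|lborel. \<bar>f X\<bar>) > 0"
    and kap: "0 < c" "c \<le> (LINT z|lborel. bump \<epsilon> (z :: real ^ 'd))"
  shows "\<exists>A. relu_adder_net n A \<and> integrable \<mu> (\<lambda>X. (f X - A X)\<^sup>2) \<and>
    (LINT X|\<mu>. (f X - A X)\<^sup>2) \<le> 2 * (\<epsilon> * L)\<^sup>2 +
      2 * ((LINT X|lborel. \<bar>f X\<bar>) * ((LINT X|\<mu>. \<bar>f X\<bar>) + \<epsilon> * L) / (c * real n))"
proof -
  interpret \<mu>: prob_space \<mu> by fact
  define N where "N = (LINT X|lborel. \<bar>f X\<bar>)"
  define F where "F = (LINT X|\<mu>. \<bar>f X\<bar>)"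
  define \<kappa> where "\<kappa> = (LINT z|lborel. bump \<epsilon> (z :: real ^ 'd))"
  define s where "s = \<epsilon> * L"
  have N0: "N > 0" using N by (simp add: N_def)
  have k0: "\<kappa> > 0" using kap by (simp add: \<kappa>_def)
  have f_meas [measurable]: "f \<in> borel_measurable borel"
    using borel_measurable_integrable[OF int] by simp
  define P where "P = density lborel (\<lambda>y. ennreal (\<bar>f y\<bar> / N))"
  have P_sets [measurable_cong]: "sets P = sets borel" by (simp add: P_def)
  have probP: "prob_space P"
    unfolding P_def N_def by (rule prob_space_normalized_density[OF int N])
  \<comment> \<open>At zeros of \<open>f\<close> the value is 1 rather than 0, so that every unit
    carries a genuine sign; \<open>\<bar>f y\<bar> * \<sigma> y = f y\<close> still holds
    there.\<close>
  define \<sigma> where "\<sigma> = (\<lambda>y. if f y < 0 then - 1 else 1 :: real)"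
  have \<sigma>_meas [measurable]: "\<sigma> \<in> borel_measurable borel" unfolding \<sigma>_def by measurable
  have \<sigma>_abs: "\<bar>f y\<bar> * \<sigma> y = f y" "\<bar>\<sigma> y\<bar> = 1" "(\<sigma> y)\<^sup>2 = 1" for y by (auto simp: \<sigma>_def)
  define g where "g = (\<lambda>y x. \<sigma> y * bump \<epsilon> (x - y))"
  have g_meas [measurable]: "case_prod g \<in> borel_measurable (P \<Otimes>\<^sub>M \<mu>)"
    unfolding g_def by measurable
  have g_bnd: "\<bar>g y x\<bar> \<le> 1" for y x
    using bump_nonneg[of \<epsilon> "x - y"] bump_le_1[OF eps, of "x - y"] by (simp add: g_def abs_mult \<sigma>_abs)
  define h where "h = (\<lambda>x. LINT y|P. g y x)"
  have h_eq: "h x = (LINT y|lborel. f y * bump \<epsilon> (x - y)) / N" for x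
  proof -
    have "h x = (LINT y|lborel. (\<bar>f y\<bar> / N) *\<^sub>R g y x)"
      unfolding h_def P_def using N0 by (subst integral_density) (auto simp: g_def)
    also have "\<dots> = (LINT y|lborel. f y * bump \<epsilon> (x - y) / N)"
    proof (rule Bochner_Integration.integral_cong[OF refl])
      fix y
      have "\<bar>f y\<bar> * (\<sigma> y * bump \<epsilon> (x - y)) = f y * bump \<epsilon> (x - y)"
        by (simp flip: mult.assoc add: \<sigma>_abs)
      then show "(\<bar>f y\<bar> / N) *\<^sub>R g y x = f y * bump \<epsilon> (x - y) / N" by (simp add: g_def)
    qed
    finally show ?thesis by simp
  qed
  have h_bnd: "\<bar>h x\<bar> \<le> 1" for x
    using abs_integral_mult_bump_le[OF eps int, of x] N0 by (simp add: h_eq N_def)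
  have h_meas [measurable]: "h \<in> borel_measurable \<mu>"
  proof -
    interpret P: prob_space P by (rule probP)
    show ?thesis unfolding h_def by measurable
  qed
  have f_bnd: "\<bar>f x\<bar> \<le> s + N / c" for x
    unfolding s_def N_def by (rule abs_lipschitz_integrable_le[OF eps L lip int kap])
  have int_f: "integrable \<mu> (\<lambda>x. \<bar>f x\<bar>)"
    by (rule \<mu>.integrable_const_bound[of _ "s + N / c"]) (auto simp: f_bnd)
  \<comment> \<open>As the bump lies between 0 and 1, its square is at most itself. Averaging the
    absolute value of \<open>f\<close>, which has the same Lipschitz constant, then keeps a factor
    \<open>\<kappa>\<close> in the bound.\<close>
  have second: "(LINT y|P. (g y x)\<^sup>2) \<le> \<kappa> / N * (\<bar>f x\<bar> + s)" for x
  proof -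
    have absf: "\<bar>\<bar>f X\<bar> - \<bar>f X'\<bar>\<bar> \<le> L * l1_norm UNIV (vec_nth (X - X'))" for X X'
      using lip[of X X'] by linarith
    have "(LINT y|P. (g y x)\<^sup>2) = (LINT y|lborel. (\<bar>f y\<bar> / N) *\<^sub>R (g y x)\<^sup>2)"
      unfolding P_def using N0 by (subst integral_density) (auto simp: g_def)
    also have "\<dots> \<le> (LINT y|lborel. \<bar>f y\<bar> * bump \<epsilon> (x - y) / N)"
    proof (rule integral_mono')
      show "integrable lborel (\<lambda>y. \<bar>f y\<bar> * bump \<epsilon> (x - y) / N)"
        using int by (intro integrable_divide integrable_mult_bump[OF eps] integrable_abs)
      fix y
      have "(g y x)\<^sup>2 \<le> bump \<epsilon> (x - y)"
        using bump_nonneg[of \<epsilon> "x - y"] bump_le_1[OF eps, of "x - y"]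
        by (simp add: g_def power_mult_distrib \<sigma>_abs) (simp add: power2_eq_square mult_left_le)
      then have "\<bar>f y\<bar> / N * (g y x)\<^sup>2 \<le> \<bar>f y\<bar> / N * bump \<epsilon> (x - y)"
        using N0 by (intro mult_left_mono) auto
      then show "(\<bar>f y\<bar> / N) *\<^sub>R (g y x)\<^sup>2 \<le> \<bar>f y\<bar> * bump \<epsilon> (x - y) / N" by simp
      show "0 \<le> \<bar>f y\<bar> * bump \<epsilon> (x - y) / N" using N0 by (simp add: bump_nonneg)
    qed
    also have "\<dots> = (LINT y|lborel. \<bar>f y\<bar> * bump \<epsilon> (x - y)) / N" by simp
    also have "\<dots> \<le> (\<kappa> * (\<bar>f x\<bar> + s)) / N"
    proof (rule divide_right_mono)
      show "(LINT y|lborel. \<bar>f y\<bar> * bump \<epsilon> (x - y)) \<le> \<kappa> * (\<bar>f x\<bar> + s)"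
        using bump_average_error[OF eps L absf integrable_abs[OF int], of x]
        by (simp add: \<kappa>_def s_def distrib_left)
    qed (use N0 in simp)
    finally show ?thesis by simp
  qed
  have V: "(LINT x|\<mu>. LINT y|P. (g y x)\<^sup>2) \<le> \<kappa> / N * (F + s)"
  proof -
    have "(LINT x|\<mu>. LINT y|P. (g y x)\<^sup>2) \<le> (LINT x|\<mu>. \<kappa> / N * (\<bar>f x\<bar> + s))"
      using int_f second k0 N0 eps L by (intro integral_mono') (auto simp: s_def)
    also have "\<dots> = \<kappa> / N * (F + s)" using int_f by (simp add: F_def \<mu>.prob_space)
    finally show ?thesis .
  qed
  obtain Y where Y: "(LINT x|\<mu>. (\<Sum>i<n. g (Y i) x - h x)\<^sup>2)
      \<le> real n * (LINT x|\<mu>. LINT y|P. (g y x)\<^sup>2)"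
    using greedy_sampling[OF probP prob g_meas g_bnd, of n] unfolding h_def by blast
  define D where "D = (\<lambda>x. \<Sum>i<n. g (Y i) x - h x)"
  \<comment> \<open>The mean \<open>h\<close> of a sample is the convolution divided by
    \<open>N\<close>, so \<open>N / \<kappa>\<close> restores the local average, and dividing by
    \<open>n\<close> turns the sum into an empirical mean.\<close>
  define a where "a = N / (\<kappa> * real n)"
  define A where "A = (\<lambda>x. a * (\<Sum>i<n. \<sigma> (Y i) * bump \<epsilon> (x - Y i)))"
  have net: "relu_adder_net n A"
    unfolding A_def by (rule relu_adder_net_signed_bumps[OF eps]) (auto simp: \<sigma>_def)
  have A_meas [measurable]: "A \<in> borel_measurable borel" unfolding A_def by measurable
  have A_eq: "A x = a * D x + N / \<kappa> * h x" for x
    using n k0 by (simp add: A_def D_def g_def a_def sum_subtractf algebra_simps)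
  have D_meas [measurable]: "D \<in> borel_measurable \<mu>"
    unfolding D_def g_def by measurable
  have D_bnd: "\<bar>D x\<bar> \<le> real n * 2" for x
  proof -
    have "\<bar>D x\<bar> \<le> (\<Sum>i<n. \<bar>g (Y i) x - h x\<bar>)" unfolding D_def by (rule sum_abs)
    also have "\<dots> \<le> (\<Sum>i<n. 2)"
    proof (rule sum_mono)
      fix i show "\<bar>g (Y i) x - h x\<bar> \<le> 2" using g_bnd[of "Y i" x] h_bnd[of x] by linarith
    qed
    finally show ?thesis by simp
  qed
  have int_D: "integrable \<mu> (\<lambda>x. (D x)\<^sup>2)"
  proof (rule \<mu>.integrable_const_bound[of _ "(real n * 2)\<^sup>2"])
    show "AE x in \<mu>. norm ((D x)\<^sup>2) \<le> (real n * 2)\<^sup>2"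
    proof (rule AE_I2)
      show "norm ((D x)\<^sup>2) \<le> (real n * 2)\<^sup>2" for x
        using power_mono[OF D_bnd[of x] abs_ge_zero, of 2] by simp
    qed
  qed measurable
  have bias: "\<bar>f x - N / \<kappa> * h x\<bar> \<le> s" for x
  proof -
    have "\<bar>\<kappa> * (f x - N / \<kappa> * h x)\<bar> \<le> \<kappa> * s"
      using bump_average_error[OF eps L lip int, of x] N0 k0
      by (simp add: h_eq \<kappa>_def[symmetric] s_def right_diff_distrib)
    then show ?thesis using k0 by (simp add: abs_mult)
  qed
  \<comment> \<open>The error is the bias \<open>u\<close> minus the scaled deviation
    \<open>a * D x\<close>; the square of a difference is at most twice the sum of the
    squares.\<close>
  have ptw: "(f x - A x)\<^sup>2 \<le> 2 * s\<^sup>2 + 2 * a\<^sup>2 * (D x)\<^sup>2" for x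
  proof -
    define u where "u = f x - N / \<kappa> * h x"
    have "(f x - A x)\<^sup>2 = (u - a * D x)\<^sup>2" by (simp add: A_eq u_def algebra_simps)
    also have "\<dots> \<le> 2 * u\<^sup>2 + 2 * (a * D x)\<^sup>2"
      using zero_le_power2[of "u + a * D x"] by (simp add: power2_eq_square algebra_simps)
    also have "u\<^sup>2 \<le> s\<^sup>2" using bias[of x] by (simp add: u_def abs_le_square_iff[symmetric])
    finally show ?thesis by (simp add: power_mult_distrib)
  qed
  have int_rhs: "integrable \<mu> (\<lambda>x. 2 * s\<^sup>2 + 2 * a\<^sup>2 * (D x)\<^sup>2)" using int_D by simp
  have int_err: "integrable \<mu> (\<lambda>x. (f x - A x)\<^sup>2)"
    using ptw by (intro Bochner_Integration.integrable_bound[OF int_rhs])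
      (auto intro: order_trans[OF _ abs_ge_self])
  have "(LINT x|\<mu>. (f x - A x)\<^sup>2) \<le> (LINT x|\<mu>. 2 * s\<^sup>2 + 2 * a\<^sup>2 * (D x)\<^sup>2)"
    using int_err int_rhs ptw by (rule integral_mono)
  also have "\<dots> = 2 * s\<^sup>2 + 2 * a\<^sup>2 * (LINT x|\<mu>. (D x)\<^sup>2)"
    using int_D by (simp add: \<mu>.prob_space)
  also have "\<dots> \<le> 2 * s\<^sup>2 + 2 * a\<^sup>2 * (real n * (\<kappa> / N * (F + s)))"
  proof -
    have "(LINT x|\<mu>. (D x)\<^sup>2) \<le> real n * (\<kappa> / N * (F + s))"
      using Y V n unfolding D_def by (meson mult_left_mono of_nat_0_le_iff order_trans)
    then show ?thesis by (intro add_left_mono mult_left_mono) auto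
  qed
  \<comment> \<open>Of the two factors \<open>1 / \<kappa>\<close> in \<open>a\<^sup>2\<close>, one
    is absorbed by the \<open>\<kappa>\<close> of the second moment.\<close>
  also have "\<dots> = 2 * s\<^sup>2 + 2 * (N * (F + s) / (\<kappa> * real n))"
    using N0 k0 n by (simp add: a_def power2_eq_square field_simps)
  also have "\<dots> \<le> 2 * s\<^sup>2 + 2 * (N * (F + s) / (c * real n))"
  proof -
    have "F \<ge> 0" "s \<ge> 0" using eps L by (auto simp: F_def s_def)
    then have "N * (F + s) / (\<kappa> * real n) \<le> N * (F + s) / (c * real n)"
      using N0 kap n by (intro divide_left_mono mult_right_mono) (auto simp: \<kappa>_def)
    then show ?thesis by simp
  qed
  finally show ?thesis using net int_err unfolding N_def F_def s_def by blast
qed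



section \<open>Choice of the width and of the constant\<close>

theorem theorem4:
  "\<exists>C > 0. \<forall>(f :: real ^ 'd \<Rightarrow> real) (L :: real) (\<mu> :: (real ^ 'd) measure) (\<epsilon> :: real).
     L > 0 \<longrightarrow>
     (\<forall>X X'. \<bar>f X - f X'\<bar> \<le> L * l1_norm UNIV (vec_nth (X - X'))) \<longrightarrow>
     integrable lborel f \<longrightarrow>
     prob_space \<mu> \<longrightarrow> sets \<mu> = sets borel \<longrightarrow>
     (LINT X|\<mu>. \<bar>f X\<bar>) \<noteq> 0 \<longrightarrow>
     \<epsilon> > 0 \<longrightarrow>
     (\<exists>t A. relu_adder_net t A \<and>
        real t \<le> (LINT X|lborel. \<bar>f X\<bar>) * (LINT X|\<mu>. \<bar>f X\<bar>) /
          min (\<epsilon> ^ (CARD('d) + 2) * L\<^sup>2) (\<epsilon> ^ (CARD('d) + 1) * L * (LINT X|\<mu>. \<bar>f X\<bar>)) \<and>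
        integrable \<mu> (\<lambda>X. (f X - A X)\<^sup>2) \<and>
        (LINT X|\<mu>. (f X - A X)\<^sup>2) \<le> C * \<epsilon>\<^sup>2 * L\<^sup>2)"
proof -
  \<comment> \<open>The dimensional factor in the lower bound for the integral of the bump.\<close>
  define C\<^sub>0 where "C\<^sub>0 = 1 / (2 * real CARD('d) ^ CARD('d))"
  have C0: "C\<^sub>0 > 0" by (simp add: C\<^sub>0_def)
  \<comment> \<open>Sum of the constants of the two cases: \<open>2 + 8 / C\<^sub>0\<close> for
    positive width, the square for width 0.\<close>
  define C where "C = 2 + 8 / C\<^sub>0 + (1 + 1 / C\<^sub>0)\<^sup>2"
  show ?thesis
  proof (intro exI[of _ C] conjI allI impI)
    show "C > 0" using C0 by (simp add: C_def add_pos_nonneg)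
  next
    fix f :: "real ^ 'd \<Rightarrow> real" and L :: real and \<mu> :: "(real ^ 'd) measure" and \<epsilon> :: real
    assume L: "L > 0" and lip: "\<forall>X X'. \<bar>f X - f X'\<bar> \<le> L * l1_norm UNIV (vec_nth (X - X'))"
      and int: "integrable lborel f" and prob: "prob_space \<mu>"
      and sets [measurable_cong]: "sets \<mu> = sets borel"
      and F_ne: "(LINT X|\<mu>. \<bar>f X\<bar>) \<noteq> 0" and eps: "\<epsilon> > 0"
    interpret \<mu>: prob_space \<mu> by fact
    have f_meas [measurable]: "f \<in> borel_measurable borel"
      using borel_measurable_integrable[OF int] by simp
    define N where "N = (LINT X|lborel. \<bar>f X\<bar>)"
    define F where "F = (LINT X|\<mu>. \<bar>f X\<bar>)"
    define s where "s = \<epsilon> * L"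
    define m where "m = \<epsilon> ^ CARD('d)"
    define d where "d = min (\<epsilon> ^ (CARD('d) + 2) * L\<^sup>2) (\<epsilon> ^ (CARD('d) + 1) * L * F)"
    define B where "B = N * F / d"
    \<comment> \<open>The largest width that the bound \<open>B\<close> permits.\<close>
    define n where "n = nat \<lfloor>B\<rfloor>"
    have F0: "F > 0" using F_ne by (simp add: F_def order_less_le)
    have N0: "N \<ge> 0" by (simp add: N_def)
    have s0: "s > 0" and m0: "m > 0" using eps L by (auto simp: s_def m_def)
    have d_eq: "d = min (m * s\<^sup>2) (m * s * F)"
      by (simp add: d_def m_def s_def power_add power_mult_distrib power2_eq_square mult_ac)
    have d0: "d > 0" using F0 s0 m0 by (simp add: d_eq)
    have B0: "B \<ge> 0" using N0 F0 d0 by (simp add: B_def)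
    \<comment> \<open>Each entry of the minimum \<open>d\<close> yields one estimate: the first
      controls \<open>N * F\<close>, the second, after cancelling \<open>F\<close>, controls
      \<open>N\<close>. These match the two terms of \<open>N * (F + s)\<close>.\<close>
    have NF: "N * F \<le> B * (m * s\<^sup>2)"
    proof -
      have "N * F = B * d" using d0 by (simp add: B_def)
      also have "\<dots> \<le> B * (m * s\<^sup>2)" using B0 by (intro mult_left_mono) (simp_all add: d_eq)
      finally show ?thesis .
    qed
    have Ns: "N \<le> B * (m * s)"
    proof -
      have "N * F = B * d" using d0 by (simp add: B_def)
      also have "\<dots> \<le> B * (m * s * F)" using B0 by (intro mult_left_mono) (simp_all add: d_eq)
      finally show ?thesis using F0 by (simp flip: mult.assoc)
    qed
    have n_le: "real n \<le> B" using B0 by (simp add: n_def)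
    have kap: "0 < C\<^sub>0 * m" "C\<^sub>0 * m \<le> (LINT z|lborel. bump \<epsilon> (z :: real ^ 'd))"
      using C0 m0 bump_integral_ge[where 'd = 'd, OF eps] by (auto simp: C\<^sub>0_def m_def)
    have Cs: "C * s\<^sup>2 = 2 * s\<^sup>2 + 8 * s\<^sup>2 / C\<^sub>0 + (1 + 1 / C\<^sub>0)\<^sup>2 * s\<^sup>2"
      by (simp add: C_def algebra_simps)
    have "\<exists>A. relu_adder_net n A \<and> integrable \<mu> (\<lambda>X. (f X - A X)\<^sup>2) \<and>
        (LINT X|\<mu>. (f X - A X)\<^sup>2) \<le> C * s\<^sup>2"
    proof (cases "n = 0")
      case True
      \<comment> \<open>Then \<open>N\<close> is at most \<open>m * s\<close>, so \<open>f\<close>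
        is everywhere of order \<open>s\<close> and the zero function is accurate enough.\<close>
      then have "B < 1" using B0 unfolding n_def by linarith
      then have "B * (m * s) \<le> 1 * (m * s)" using m0 s0 by (intro mult_right_mono) auto
      then have "N \<le> m * s" using Ns by linarith
      then have "N / (C\<^sub>0 * m) \<le> s / C\<^sub>0" using C0 m0 by (simp add: field_simps)
      then have f_le: "\<bar>f x\<bar> \<le> (1 + 1 / C\<^sub>0) * s" for x
        using abs_lipschitz_integrable_le[OF eps less_imp_le[OF L] _ int kap, of x] lip
        by (simp add: s_def N_def algebra_simps)
      have sq: "(f x)\<^sup>2 \<le> (1 + 1 / C\<^sub>0)\<^sup>2 * s\<^sup>2" for x
        using power_mono[OF f_le[of x] abs_ge_zero, of 2] by (simp add: power_mult_distrib)
      have int_sq: "integrable \<mu> (\<lambda>X. (f X)\<^sup>2)"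
        using sq by (intro \<mu>.integrable_const_bound[of _ "(1 + 1 / C\<^sub>0)\<^sup>2 * s\<^sup>2"]) auto
      then have "(LINT X|\<mu>. (f X)\<^sup>2) \<le> (LINT X|\<mu>. (1 + 1 / C\<^sub>0)\<^sup>2 * s\<^sup>2)"
        using sq by (intro integral_mono) auto
      also have "\<dots> \<le> C * s\<^sup>2" using C0 by (simp add: \<mu>.prob_space Cs)
      finally have "(LINT X|\<mu>. (f X)\<^sup>2) \<le> C * s\<^sup>2" .
      moreover have "relu_adder_net n (\<lambda>X :: real ^ 'd. 0)"
        using relu_adder_net_signed_bumps[OF eps, of "\<lambda>_. 1" n 0 "\<lambda>_. 0 :: real ^ 'd"] by simp
      ultimately show ?thesis using int_sq by (intro exI[of _ "\<lambda>_. 0"]) simp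
    next
      case False
      then have n0: "n > 0" by simp
      \<comment> \<open>Once the floor is at least 1, rounding down loses at most a factor
        2.\<close>
      have n_ge: "B \<le> 2 * real n"
        using False B0 unfolding n_def by linarith
      \<comment> \<open>The sampling density is normalised by \<open>N\<close>; if \<open>N\<close>
        vanished, so would \<open>B\<close> and hence \<open>n\<close>.\<close>
      have "N > 0"
      proof (rule ccontr)
        assume "\<not> N > 0"
        then have "B = 0" using N0 by (simp add: B_def)
        then show False using False by (simp add: n_def)
      qed
      then have Npos: "(LINT X|lborel. \<bar>f X\<bar>) > 0" by (simp add: N_def)
      obtain A where A: "relu_adder_net n A" "integrable \<mu> (\<lambda>X. (f X - A X)\<^sup>2)"
        "(LINT X|\<mu>. (f X - A X)\<^sup>2) \<le> 2 * s\<^sup>2 + 2 * (N * (F + s) / ((C\<^sub>0 * m) * real n))"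
        using sampled_net_error[OF eps less_imp_le[OF L] _ int prob sets n0 Npos kap] lip
        unfolding N_def F_def s_def by blast
      have "N * (F + s) \<le> B * (m * s\<^sup>2) + B * (m * s) * s"
        unfolding distrib_left using NF Ns s0 by (intro add_mono mult_right_mono) auto
      also have "\<dots> = B * (2 * (m * s\<^sup>2))" by (simp add: power2_eq_square)
      also have "\<dots> \<le> (2 * real n) * (2 * (m * s\<^sup>2))"
        using n_ge m0 by (intro mult_right_mono) auto
      finally have "N * (F + s) / (m * real n) \<le> 4 * s\<^sup>2"
        using m0 n0 by (simp add: field_simps)
      then have "N * (F + s) / (m * real n) / C\<^sub>0 \<le> 4 * s\<^sup>2 / C\<^sub>0"
        using C0 by (intro divide_right_mono) auto
      then have "N * (F + s) / ((C\<^sub>0 * m) * real n) \<le> 4 * s\<^sup>2 / C\<^sub>0"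
        by (simp add: mult_ac)
      then have "(LINT X|\<mu>. (f X - A X)\<^sup>2) \<le> 2 * s\<^sup>2 + 8 * s\<^sup>2 / C\<^sub>0" using A(3) by simp
      also have "\<dots> \<le> C * s\<^sup>2" by (simp add: Cs)
      finally show ?thesis using A by blast
    qed
    then show "\<exists>t A. relu_adder_net t A \<and>
        real t \<le> (LINT X|lborel. \<bar>f X\<bar>) * (LINT X|\<mu>. \<bar>f X\<bar>) /
          min (\<epsilon> ^ (CARD('d) + 2) * L\<^sup>2) (\<epsilon> ^ (CARD('d) + 1) * L * (LINT X|\<mu>. \<bar>f X\<bar>)) \<and>
        integrable \<mu> (\<lambda>X. (f X - A X)\<^sup>2) \<and>
        (LINT X|\<mu>. (f X - A X)\<^sup>2) \<le> C * \<epsilon>\<^sup>2 * L\<^sup>2"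
      using n_le unfolding B_def d_def N_def F_def s_def
      by (auto simp: power_mult_distrib mult.assoc)
  qed
qed

end
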